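(* Let $g_{11},g_{21},g_{12},g_{22}>0$ and $P_1,P_2>0$. Over all power allocations $(P_{11},P_{21},P_{12},P_{22})$ with $P_{jk}\ge 0$ for $j,k\in\{1,2\}$, $P_{11}+P_{21}\le P_1$ and $P_{12}+P_{22}\le P_2$, the maximum of the sum rate $R_1+R_2$, where $$R_1=\log_2\Big(1+\frac{g_{11}P_{11}+g_{12}P_{12}}{1+g_{11}P_{21}+g_{12}P_{22}}\Big),\qquad R_2=\log_2\Big(1+\frac{g_{21}P_{21}+g_{22}P_{22}}{1+g_{21}P_{11}+g_{22}P_{12}}\Big),$$ is achieved at one of the following four corner points $(P_{11},P_{21},P_{12},P_{22})$: $$(P_1,0,P_2,0),\quad (0,P_1,0,P_2),\quad (0,P_1,P_2,0),\quad (P_1,0,0,P_2).$$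
   Context: Here $g_{jk}$ is the channel gain from base station $k$ to mobile $j$, $P_{jk}$ is the power base station $k$ allocates to mobile $j$, $P_k$ is the power budget of base station $k$, and $R_j$ is the rate of mobile $j$. *)

theory Defs
  imports Complex_Main
begin

text \<open>In \<open>g\<^sub>j\<^sub>k\<close> and \<open>p\<^sub>j\<^sub>k\<close> the first index is the mobile and the second the base station.
  A power allocation is the tuple \<open>(p11, p21, p12, p22)\<close>, in this order.\<close>

type_synonym allocation = "real \<times> real \<times> real \<times> real"

definition feasible :: "real \<Rightarrow> real \<Rightarrow> allocation set" where
  "feasible P1 P2 = {(p11, p21, p12, p22).
     0 \<le> p11 \<and> 0 \<le> p21 \<and> 0 \<le> p12 \<and> 0 \<le> p22 \<and> p11 + p21 \<le> P1 \<and> p12 + p22 \<le> P2}"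

fun rate1 :: "real \<Rightarrow> real \<Rightarrow> allocation \<Rightarrow> real" where
  "rate1 g11 g12 (p11, p21, p12, p22) =
     log 2 (1 + (g11 * p11 + g12 * p12) / (1 + g11 * p21 + g12 * p22))"

fun rate2 :: "real \<Rightarrow> real \<Rightarrow> allocation \<Rightarrow> real" where
  "rate2 g21 g22 (p11, p21, p12, p22) =
     log 2 (1 + (g21 * p21 + g22 * p22) / (1 + g21 * p11 + g22 * p12))"

definition sum_rate :: "real \<Rightarrow> real \<Rightarrow> real \<Rightarrow> real \<Rightarrow> allocation \<Rightarrow> real" where
  "sum_rate g11 g21 g12 g22 p = rate1 g11 g12 p + rate2 g21 g22 p"

end

theory Submission
  imports Defs
begin

text \<open>
  Clearing denominators, \<open>R\<^sub>1 + R\<^sub>2 \<le> log\<^sub>2 M\<close> becomes \<open>num \<le> M * den\<close>. In the powers \<open>(x, y)\<close> of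
  a single base station, \<open>num - M * den\<close> is a quadratic that is convex in \<open>x\<close>, in \<open>y\<close> and along
  \<open>(1, -1)\<close>, so on the triangle \<open>x, y \<ge> 0, x + y \<le> P\<close> it is at most \<open>0\<close> as soon as it is so at the
  three vertices. Doing this for both base stations leaves nine points. Four of them are the
  corner points; in the other five some base station is silent, and the sum rate there does not
  exceed that of serving a single mobile with full power.
\<close>

text \<open>By convexity the graph lies below the chord over \<open>[0, L]\<close>, whose endpoint
  values are at most 0. Multiplied by \<open>L\<close>, the gap to the chord is exactly
  \<open>\<alpha> * L * x * (L - x)\<close>.\<close>

lemma convex_quadratic_nonpos:
  fixes \<alpha> \<beta> \<gamma> L x :: real
  assumes "0 \<le> \<alpha>" "0 \<le> x" "x \<le> L"
    and "\<gamma> \<le> 0" and "\<alpha> * L\<^sup>2 + \<beta> * L + \<gamma> \<le> 0"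
  shows "\<alpha> * x\<^sup>2 + \<beta> * x + \<gamma> \<le> 0"
proof (cases "L = 0")
  case True
  then show ?thesis using assms by simp
next
  case False
  then have "0 < L" using assms by simp
  have "L * (\<alpha> * x\<^sup>2 + \<beta> * x + \<gamma>)
      = x * (\<alpha> * L\<^sup>2 + \<beta> * L + \<gamma>) + (L - x) * \<gamma> - \<alpha> * (L * (x * (L - x)))"
    by (simp add: algebra_simps power2_eq_square)
  also have "\<dots> \<le> 0"
  proof -
    have "x * (\<alpha> * L\<^sup>2 + \<beta> * L + \<gamma>) \<le> 0" "(L - x) * \<gamma> \<le> 0"
      using assms by (simp_all add: mult_nonneg_nonpos)
    moreover have "0 \<le> \<alpha> * (L * (x * (L - x)))"
      using assms \<open>0 < L\<close> by simp
    ultimately show ?thesis by linarith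
  qed
  finally show ?thesis using \<open>0 < L\<close> by (simp add: mult_le_0_iff)
qed

lemma convex_quadratic_triangle_nonpos:
  fixes \<alpha> \<beta> \<delta> \<rho> \<mu> \<kappa> P x y :: real
  assumes "0 \<le> \<alpha>" "0 \<le> \<beta>" "\<delta> \<le> \<alpha> + \<beta>"
    and "0 \<le> x" "0 \<le> y" "x + y \<le> P"
    and v0: "\<kappa> \<le> 0" and vx: "\<alpha> * P\<^sup>2 + \<rho> * P + \<kappa> \<le> 0" and vy: "\<beta> * P\<^sup>2 + \<mu> * P + \<kappa> \<le> 0"
  shows "\<alpha> * x\<^sup>2 + \<delta> * x * y + \<beta> * y\<^sup>2 + \<rho> * x + \<mu> * y + \<kappa> \<le> 0"
proof -
  let ?s = "x + y"
  have ex: "\<alpha> * ?s\<^sup>2 + \<rho> * ?s + \<kappa> \<le> 0"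
    by (rule convex_quadratic_nonpos[OF _ _ _ v0 vx]) (use assms in auto)
  have ey: "\<beta> * ?s\<^sup>2 + \<mu> * ?s + \<kappa> \<le> 0"
    by (rule convex_quadratic_nonpos[OF _ _ _ v0 vy]) (use assms in auto)
  \<comment> \<open>Restriction to the segment from \<open>(0, ?s)\<close> to
    \<open>(?s, 0)\<close>, with \<open>y = ?s - x\<close>; its ends are covered by
    \<open>ey\<close> and \<open>ex\<close>.\<close>
  have "(\<alpha> + \<beta> - \<delta>) * x\<^sup>2 + (\<delta> * ?s - 2 * \<beta> * ?s + \<rho> - \<mu>) * x + (\<beta> * ?s\<^sup>2 + \<mu> * ?s + \<kappa>) \<le> 0"
  proof (rule convex_quadratic_nonpos[where L = ?s])
    show "(\<alpha> + \<beta> - \<delta>) * ?s\<^sup>2 + (\<delta> * ?s - 2 * \<beta> * ?s + \<rho> - \<mu>) * ?s + (\<beta> * ?s\<^sup>2 + \<mu> * ?s + \<kappa>) \<le> 0"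
      using ex by (simp add: algebra_simps power2_eq_square)
  qed (use assms ey in auto)
  then show ?thesis by (simp add: algebra_simps power2_eq_square)
qed

text \<open>The case \<open>\<alpha> = \<beta> = ?H\<close>, \<open>\<delta> = (2 - M) * ?H\<close>,
  so that \<open>\<alpha> + \<beta> - \<delta> = M * ?H\<close> is nonnegative. The \<open>k\<close>
  and \<open>e\<close> collect noise and the other base station's contribution, and the last three
  hypotheses are the values at the vertices.\<close>

lemma product_bound_triangle:
  fixes h1 h2 k1 k2 e1 e2 M P x y :: real
  assumes "0 \<le> h1" "0 \<le> h2" "0 \<le> M"
    and "0 \<le> x" "0 \<le> y" "x + y \<le> P"
    and "k1 * k2 \<le> M * (e1 * e2)"
    and "(k1 + h1 * P) * (k2 + h2 * P) \<le> M * (e1 * (e2 + h2 * P))"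
    and "(k1 + h1 * P) * (k2 + h2 * P) \<le> M * ((e1 + h1 * P) * e2)"
  shows "(k1 + h1 * (x + y)) * (k2 + h2 * (x + y)) \<le> M * ((e1 + h1 * y) * (e2 + h2 * x))"
proof -
  let ?H = "h1 * h2"
  have "?H * x\<^sup>2 + (2 * ?H - M * ?H) * x * y + ?H * y\<^sup>2
      + (k1 * h2 + h1 * k2 - M * (e1 * h2)) * x + (k1 * h2 + h1 * k2 - M * (h1 * e2)) * y
      + (k1 * k2 - M * (e1 * e2)) \<le> 0"
    by (rule convex_quadratic_triangle_nonpos[where P = P])
      (use assms in \<open>auto simp: algebra_simps power2_eq_square\<close>)
  then show ?thesis by (simp add: algebra_simps power2_eq_square)
qed

text \<open>The quotient of \<open>num\<close> by \<open>den\<close> is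
  \<open>2 powr (R1 + R2)\<close>: total received power plus noise at both mobiles, over
  interference plus noise.\<close>

fun num :: "real \<Rightarrow> real \<Rightarrow> real \<Rightarrow> real \<Rightarrow> allocation \<Rightarrow> real" where
  "num g11 g21 g12 g22 (p11, p21, p12, p22) =
     (1 + g11 * (p11 + p21) + g12 * (p12 + p22)) * (1 + g21 * (p11 + p21) + g22 * (p12 + p22))"

fun den :: "real \<Rightarrow> real \<Rightarrow> real \<Rightarrow> real \<Rightarrow> allocation \<Rightarrow> real" where
  "den g11 g21 g12 g22 (p11, p21, p12, p22) =
     (1 + g11 * p21 + g12 * p22) * (1 + g21 * p11 + g22 * p12)"

context
  fixes g11 g21 g12 g22 P1 P2 :: real
  assumes g_pos: "g11 > 0" "g21 > 0" "g12 > 0" "g22 > 0" and P_pos: "P1 > 0" "P2 > 0"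
begin

lemma sum_rate_le_iff:
  assumes q: "q \<in> feasible P1 P2" and "0 < M"
  shows "sum_rate g11 g21 g12 g22 q \<le> log 2 M
    \<longleftrightarrow> num g11 g21 g12 g22 q \<le> M * den g11 g21 g12 g22 q"
proof -
  obtain a b c d where q_eq: "q = (a, b, c, d)" by (cases q)
  have nonneg: "0 \<le> a" "0 \<le> b" "0 \<le> c" "0 \<le> d"
    using q by (auto simp: q_eq feasible_def)
  define n1 n2 d1 d2 where
    defs: "n1 = 1 + g11 * (a + b) + g12 * (c + d)" "n2 = 1 + g21 * (a + b) + g22 * (c + d)"
      "d1 = 1 + g11 * b + g12 * d" "d2 = 1 + g21 * a + g22 * c"
  have pos: "0 < n1" "0 < n2" "0 < d1" "0 < d2"
    using nonneg g_pos by (auto simp: defs intro!: add_pos_nonneg)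
  have "1 + (g11 * a + g12 * c) / d1 = n1 / d1" "1 + (g21 * b + g22 * d) / d2 = n2 / d2"
    using pos by (simp_all add: field_simps) (simp_all add: defs algebra_simps)
  then have "sum_rate g11 g21 g12 g22 q = log 2 (n1 / d1) + log 2 (n2 / d2)"
    by (simp add: q_eq sum_rate_def defs(3,4))
  also have "\<dots> = log 2 ((n1 * n2) / (d1 * d2))"
    using pos by (subst log_mult_pos[symmetric]) simp_all
  finally have "sum_rate g11 g21 g12 g22 q \<le> log 2 M \<longleftrightarrow> (n1 * n2) / (d1 * d2) \<le> M"
    using pos \<open>0 < M\<close> by simp
  also have "\<dots> \<longleftrightarrow> n1 * n2 \<le> M * (d1 * d2)"
    using pos by (simp add: pos_divide_le_eq)
  finally show ?thesis by (simp add: q_eq defs)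
qed

lemma num_le_den_of_corners:
  assumes q: "(a, b, c, d) \<in> feasible P1 P2"
    and corners: "\<And>p. p \<in> {(P1, 0, P2, 0), (0, P1, 0, P2), (0, P1, P2, 0), (P1, 0, 0, P2)}
      \<Longrightarrow> num g11 g21 g12 g22 p \<le> M * den g11 g21 g12 g22 p"
  shows "num g11 g21 g12 g22 (a, b, c, d) \<le> M * den g11 g21 g12 g22 (a, b, c, d)"
proof -
  have nonneg: "0 \<le> a" "0 \<le> b" "0 \<le> c" "0 \<le> d" and budget: "a + b \<le> P1" "c + d \<le> P2"
    using q by (auto simp: feasible_def)
  note G = less_imp_le[OF g_pos(1)] less_imp_le[OF g_pos(2)]
    less_imp_le[OF g_pos(3)] less_imp_le[OF g_pos(4)]
  define u1 u2 v1 v2 where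
    uv: "u1 = g11 * P1" "u2 = g21 * P1" "v1 = g12 * P2" "v2 = g22 * P2"
  have uv_pos: "0 < u1" "0 < u2" "0 < v1" "0 < v2"
    using g_pos P_pos by (simp_all add: uv)
  have c1: "(1 + u1 + v1) * (1 + u2 + v2) \<le> M * (1 + u2 + v2)"
    and c2: "(1 + u1 + v1) * (1 + u2 + v2) \<le> M * (1 + u1 + v1)"
    and c3: "(1 + u1 + v1) * (1 + u2 + v2) \<le> M * ((1 + u1) * (1 + v2))"
    and c4: "(1 + u1 + v1) * (1 + u2 + v2) \<le> M * ((1 + v1) * (1 + u2))"
    using corners[of "(P1, 0, P2, 0)"] corners[of "(0, P1, 0, P2)"]
      corners[of "(0, P1, P2, 0)"] corners[of "(P1, 0, 0, P2)"]
    by (simp_all add: uv)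
  \<comment> \<open>When both stations serve the same mobile, the other mobile's factor occurs in
    both \<open>num\<close> and \<open>den\<close> and cancels.\<close>
  have M1: "1 + u1 + v1 \<le> M" and M2: "1 + u2 + v2 \<le> M"
    using c1 c2 uv_pos by (simp_all add: mult.commute)
  have "0 \<le> M" using M1 uv_pos by linarith
  note T1 = product_bound_triangle[OF G(1,2) \<open>0 \<le> M\<close> nonneg(1,2) budget(1)]
  note T2 = product_bound_triangle[OF G(3,4) \<open>0 \<le> M\<close> nonneg(3,4) budget(2)]
  have le: "1 \<le> M" "1 + u1 \<le> M" "1 + u2 \<le> M" "1 + v1 \<le> M" "1 + v2 \<le> M"
    using M1 M2 uv_pos by linarith+
  have mono: "m * n \<le> M * n" "n * m \<le> M * n" if "m \<le> M" "0 \<le> n" for m n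
    using that by (simp_all add: mult_right_mono mult.commute[of n])
  \<comment> \<open>Station 2 at the vertex \<open>(0, 0)\<close>: one factor cancels at each vertex
    of station 1, and \<open>M\<close> dominates the other.\<close>
  have silent: "(1 + g11 * (a + b)) * (1 + g21 * (a + b)) \<le> M * ((1 + g11 * b) * (1 + g21 * a))"
  proof (rule T1; unfold uv[symmetric] mult_1_left mult_1_right)
    show "1 \<le> M" by (rule le)
    show "(1 + u1) * (1 + u2) \<le> M * (1 + u2)" by (rule mono) (use le uv_pos in linarith)+
    show "(1 + u1) * (1 + u2) \<le> M * (1 + u1)" by (rule mono) (use le uv_pos in linarith)+
  qed
  \<comment> \<open>Station 2 at \<open>(P2, 0)\<close>: the vertices of station 1 are silence and
    two corner points, the mixed one being \<open>c3\<close>.\<close>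
  have mobile1: "(1 + v1 + g11 * (a + b)) * (1 + v2 + g21 * (a + b))
      \<le> M * ((1 + g11 * b) * (1 + v2 + g21 * a))"
  proof (rule T1; unfold uv[symmetric] mult_1_left)
    show "(1 + v1) * (1 + v2) \<le> M * (1 + v2)" by (rule mono) (use le uv_pos in linarith)+
    show "(1 + v1 + u1) * (1 + v2 + u2) \<le> M * (1 + v2 + u2)"
      by (rule mono) (use M1 uv_pos in linarith)+
    show "(1 + v1 + u1) * (1 + v2 + u2) \<le> M * ((1 + u1) * (1 + v2))"
      using c3 by (simp only: add_ac)
  qed
  \<comment> \<open>Station 2 at \<open>(0, P2)\<close>, with \<open>c4\<close> as the mixed
    corner.\<close>
  have mobile2: "(1 + v1 + g11 * (a + b)) * (1 + v2 + g21 * (a + b))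
      \<le> M * ((1 + v1 + g11 * b) * (1 + g21 * a))"
  proof (rule T1; unfold uv[symmetric] mult_1_right)
    show "(1 + v1) * (1 + v2) \<le> M * (1 + v1)" by (rule mono) (use le uv_pos in linarith)+
    show "(1 + v1 + u1) * (1 + v2 + u2) \<le> M * ((1 + v1) * (1 + u2))"
      using c4 by (simp only: add_ac)
    show "(1 + v1 + u1) * (1 + v2 + u2) \<le> M * (1 + v1 + u1)"
      by (rule mono) (use M2 uv_pos in linarith)+
  qed
  \<comment> \<open>With \<open>(a, b)\<close> fixed, the three bounds just proved are the vertex
    conditions for station 2.\<close>
  have "(1 + g11 * (a + b) + g12 * (c + d)) * (1 + g21 * (a + b) + g22 * (c + d))
      \<le> M * ((1 + g11 * b + g12 * d) * (1 + g21 * a + g22 * c))"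
    by (rule T2; (unfold uv[symmetric])?) (use silent mobile1 mobile2 in \<open>simp_all only: add_ac\<close>)
  then show ?thesis by simp
qed

lemma corner_is_arg_max:
  defines "C \<equiv> {(P1, 0, P2, 0), (0, P1, 0, P2), (0, P1, P2, 0), (P1, 0, 0, P2)}"
  shows "\<exists>p\<in>C. is_arg_max (sum_rate g11 g21 g12 g22) (\<lambda>q. q \<in> feasible P1 P2) p"
proof -
  let ?R = "sum_rate g11 g21 g12 g22"
  have feas: "C \<subseteq> feasible P1 P2"
    using P_pos by (auto simp: C_def feasible_def)
  have "finite (?R ` C)" "?R ` C \<noteq> {}" by (simp_all add: C_def)
  then have "Max (?R ` C) \<in> ?R ` C" by (rule Max_in)
  then obtain p where p: "p \<in> C" "?R p = Max (?R ` C)" by (metis imageE)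
  have R_le: "?R r \<le> ?R p" if "r \<in> C" for r
    unfolding p(2) using that \<open>finite (?R ` C)\<close> by (simp only: Max_ge imageI)
  \<comment> \<open>\<open>M\<close> encodes the best corner rate, so that
    \<open>sum_rate_le_iff\<close> passes to polynomials at the corners and back to rates at
    \<open>q\<close>.\<close>
  define M where "M = 2 powr ?R p"
  have M: "0 < M" "?R p = log 2 M" by (simp_all add: M_def)
  have "?R q \<le> ?R p" if q: "q \<in> feasible P1 P2" for q
  proof -
    obtain a b c d where q_eq: "q = (a, b, c, d)" by (cases q)
    have "num g11 g21 g12 g22 q \<le> M * den g11 g21 g12 g22 q"
      unfolding q_eq
    proof (rule num_le_den_of_corners)
      fix r assume "r \<in> {(P1, 0, P2, 0), (0, P1, 0, P2), (0, P1, P2, 0), (P1, 0, 0, P2)}"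
      then have "r \<in> C" by (simp only: C_def)
      then show "num g11 g21 g12 g22 r \<le> M * den g11 g21 g12 g22 r"
        using sum_rate_le_iff[of r M] R_le[OF \<open>r \<in> C\<close>] subsetD[OF feas \<open>r \<in> C\<close>] M
        by simp
    qed (use q q_eq in simp)
    then show ?thesis using sum_rate_le_iff[OF q M(1)] M(2) by simp
  qed
  then show ?thesis
    using p(1) subsetD[OF feas p(1)] by (metis is_arg_max_def not_less)
qed

end

theorem proposition1:
  fixes g11 g21 g12 g22 P1 P2 :: real
  assumes "g11 > 0" and "g21 > 0" and "g12 > 0" and "g22 > 0"
    and "P1 > 0" and "P2 > 0"
  shows "\<exists>p \<in> {(P1, 0, P2, 0), (0, P1, 0, P2), (0, P1, P2, 0), (P1, 0, 0, P2)}.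
           is_arg_max (sum_rate g11 g21 g12 g22) (\<lambda>q. q \<in> feasible P1 P2) p"
  using assms by (rule corner_is_arg_max)

end
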